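(* Let $n\ge 3$, $d\ge 2$, and consider an evolution, on the time interval $(-\infty,\infty)$, of $n$ hard balls $B_1,\dots,B_n$ in $\mathbb{R}^d$ of equal masses and radii $1$, colliding elastically, with no simultaneous collisions. Let $x^k(t)\in\mathbb{R}^d$ and $v^k(t)\in\mathbb{R}^d$ be the center and velocity of $B_k$ at time $t$, and let $\mathbf{x}(0)=(x^1(0),\dots,x^n(0))\in\mathbb{R}^{nd}$. Assume that the total momentum of the balls is $0$, i.e. $\sum_{k=1}^n v^k=0$, and that their total energy is $1$, i.e. $\sum_{k=1}^n |v^k|^2=1$. Then the family of all $n$ balls can be partitioned into two non-empty subfamilies such that no ball from the first subfamily ever collides with a ball from the second subfamily after time $100\,n^3\,|\mathbf{x}(0)|$.
   Context: Hard ball dynamics: $n$ balls in $\mathbb{R}^d$ have radius $1$ and equal masses. The centers $x^k(t)$ are continuous functions of $t\in\mathbb{R}$ with $|x^j(t)-x^k(t)|\ge 2$ for $j\ne k$ (balls do not overlap), and velocities $v^k$ are constant between collisions. Balls $j$ and $k$ collide at time $t$ if $|x^j(t)-x^k(t)|=2$ and their velocities change at time $t$. In that case the velocities just before the collision satisfy $(v^j(t-)-v^k(t-))\cdot(x^j(t)-x^k(t))<0$ and, with $x^{jk}(t)=(x^j(t)-x^k(t))/|x^j(t)-x^k(t)|$, $$v^j(t+)=v^j(t-)+(v^k(t-)\cdot x^{jk}(t))x^{jk}(t)-(v^j(t-)\cdot x^{jk}(t))x^{jk}(t),$$ $$v^k(t+)=v^k(t-)+(v^j(t-)\cdot x^{jk}(t))x^{jk}(t)-(v^k(t-)\cdot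 x^{jk}(t))x^{jk}(t).$$ The velocity of a ball changes only at its collisions. No simultaneous collisions: there is no time $t$ and no collection of at least three balls such that any two balls of the collection are linked by a chain of balls in which consecutive balls are in contact at time $t$. (Two disjoint touching pairs at the same time are allowed.) Consequently there are only finitely many collisions in every finite time interval. The energy is measured as $|\mathbf{v}(t+)|^2=\sum_k |v^k(t+)|^2$; it and the total momentum are conserved. $|\cdot|$ is the Euclidean norm. *)

theory Defs
  imports "HOL-Analysis.Analysis"
begin

text \<open>
  A trajectory is a function \<open>x :: real \<Rightarrow> real^'d^'n\<close>: the balls are indexed by \<open>'n\<close>, and
  \<open>x t $ k\<close> is the centre of ball \<open>k\<close> at time \<open>t\<close>. The norm of the nested vector \<open>x t\<close> is the
  Euclidean norm on the space of dimension \<open>CARD('n) * CARD('d)\<close>.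

  The velocities are read off from the trajectory. The one-sided velocities \<open>v(t-)\<close> and
  \<open>v(t+)\<close> are the left and right derivatives, whose existence is required in the locale below;
  the centres move affinely between collisions, and collisions are isolated when none are
  simultaneous, so they are then also the one-sided limits of the velocity.
\<close>

definition vel_before :: "(real \<Rightarrow> real^'d^'n) \<Rightarrow> real \<Rightarrow> real^'d^'n" where
  "vel_before x t = vector_derivative x (at_left t)"

definition vel_after :: "(real \<Rightarrow> real^'d^'n) \<Rightarrow> real \<Rightarrow> real^'d^'n" where
  "vel_after x t = vector_derivative x (at_right t)"

definition in_contact :: "(real \<Rightarrow> real^'d^'n) \<Rightarrow> real \<Rightarrow> 'n \<Rightarrow> 'n \<Rightarrow> bool" where
  "in_contact x t j k \<longleftrightarrow> j \<noteq> k \<and> norm (x t $ j - x t $ k) = 2"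

text \<open>Touching balls whose velocities do not change (grazing contact) do not collide.\<close>

definition collide :: "(real \<Rightarrow> real^'d^'n) \<Rightarrow> real \<Rightarrow> 'n \<Rightarrow> 'n \<Rightarrow> bool" where
  "collide x t j k \<longleftrightarrow> in_contact x t j k
     \<and> vel_after x t $ j \<noteq> vel_before x t $ j
     \<and> vel_after x t $ k \<noteq> vel_before x t $ k"

definition contact_dir :: "(real \<Rightarrow> real^'d^'n) \<Rightarrow> real \<Rightarrow> 'n \<Rightarrow> 'n \<Rightarrow> real^'d" where
  "contact_dir x t j k = (x t $ j - x t $ k) /\<^sub>R norm (x t $ j - x t $ k)"

locale hard_ball_evolution =
  fixes x :: "real \<Rightarrow> real^'d^'n"
  assumes continuous: "continuous_on UNIV x"
    and no_overlap: "\<And>t j k. j \<noteq> k \<Longrightarrow> norm (x t $ j - x t $ k) \<ge> 2"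
    and velocities_exist:
      "\<And>t. x differentiable (at_left t)" "\<And>t. x differentiable (at_right t)"
    and velocity_constant:
      "\<And>k a b. a < b \<Longrightarrow> (\<And>t j. a < t \<Longrightarrow> t < b \<Longrightarrow> \<not> collide x t j k) \<Longrightarrow>
         \<exists>w. \<forall>t\<in>{a<..<b}. ((\<lambda>s. x s $ k) has_vector_derivative w) (at t)"
    and incoming:
      "\<And>t j k. collide x t j k \<Longrightarrow>
         (vel_before x t $ j - vel_before x t $ k) \<bullet> (x t $ j - x t $ k) < 0"
    and collision_law:
      "\<And>t j k. collide x t j k \<Longrightarrow>
         vel_after x t $ j = vel_before x t $ j
           + (vel_before x t $ k \<bullet> contact_dir x t j k) *\<^sub>R contact_dir x t j k
           - (vel_before x t $ j \<bullet> contact_dir x t j k) *\<^sub>R contact_dir x t j k"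
      "\<And>t j k. collide x t j k \<Longrightarrow>
         vel_after x t $ k = vel_before x t $ k
           + (vel_before x t $ j \<bullet> contact_dir x t j k) *\<^sub>R contact_dir x t j k
           - (vel_before x t $ k \<bullet> contact_dir x t j k) *\<^sub>R contact_dir x t j k"

definition no_simultaneous_collisions :: "(real \<Rightarrow> real^'d^'n) \<Rightarrow> bool" where
  "no_simultaneous_collisions x \<longleftrightarrow>
     \<not> (\<exists>t S. card S \<ge> 3 \<and> (\<forall>j\<in>S. \<forall>k\<in>S. (in_contact x t)\<^sup>*\<^sup>* j k))"

definition total_momentum :: "(real \<Rightarrow> real^'d^'n) \<Rightarrow> real \<Rightarrow> real^'d" where
  "total_momentum x t = (\<Sum>k\<in>UNIV. vel_after x t $ k)"

definition total_energy :: "(real \<Rightarrow> real^'d^'n) \<Rightarrow> real \<Rightarrow> real" where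
  "total_energy x t = (\<Sum>k\<in>UNIV. (norm (vel_after x t $ k))\<^sup>2)"

end

theory Submission
  imports Defs
begin

text \<open>
  Write \<open>r = |x(0)|\<close>. The velocity vector has constant norm 1, and every collision increases
  \<open>x \<bullet> v\<close>, so \<open>t - r \<le> |x(t)| \<le> t + r\<close>. Together with \<open>|x(t) - x(s)| \<le> t - s\<close> the
  polarization identity gives \<open>x(t) \<bullet> x(s) \<ge> (t - r) (s - r)\<close>, so that for \<open>T = 100 n\<^sup>3 r\<close> and all
  \<open>t > T\<close> the vectors \<open>x(t) / t\<close> and \<open>w = x(T) / T\<close> differ by at most a small multiple of
  \<open>n\<close> to the power \<open>-3/2\<close>. Since \<open>|w|\<close> is almost 1 and the components of \<open>w\<close> almost sum to 0,
  these components split into two groups whose distance is larger than that; two balls from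
  different groups can then never touch after time \<open>T\<close>.
\<close>

section \<open>Sums over paired indices and motion at constant velocity\<close>

text \<open>Meant for the map that swaps collision partners: being a bijection, it makes the sum
  over \<open>k\<close> of the paired terms count each side exactly twice.\<close>

lemma sum_involution_le:
  fixes f g :: "'a::finite \<Rightarrow> real"
  assumes inv: "\<And>k. \<sigma> (\<sigma> k) = k"
    and le: "\<And>k. f k + f (\<sigma> k) \<le> g k + g (\<sigma> k)"
  shows "sum f UNIV \<le> sum g UNIV"
proof -
  have bij: "bij \<sigma>"
    using inv by (metis o_bij comp_apply eq_id_iff)
  have "(\<Sum>k\<in>UNIV. f k + f (\<sigma> k)) \<le> (\<Sum>k\<in>UNIV. g k + g (\<sigma> k))"
    by (intro sum_mono le)
  then show ?thesis
    using sum.reindex_bij_betw[OF bij, of f] sum.reindex_bij_betw[OF bij, of g]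
    by (simp add: sum.distrib)
qed

lemma sum_involution_eq:
  fixes f g :: "'a::finite \<Rightarrow> 'b::real_vector"
  assumes inv: "\<And>k. \<sigma> (\<sigma> k) = k"
    and eq: "\<And>k. f k + f (\<sigma> k) = g k + g (\<sigma> k)"
  shows "sum f UNIV = sum g UNIV"
proof -
  have bij: "bij \<sigma>"
    using inv by (metis o_bij comp_apply eq_id_iff)
  have "(\<Sum>k\<in>UNIV. f k + f (\<sigma> k)) = (\<Sum>k\<in>UNIV. g k + g (\<sigma> k))"
    by (intro sum.cong refl eq)
  then have "2 *\<^sub>R sum f UNIV = 2 *\<^sub>R sum g UNIV"
    using sum.reindex_bij_betw[OF bij, of f] sum.reindex_bij_betw[OF bij, of g]
    by (simp add: sum.distrib scaleR_2)
  then show ?thesis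
    by simp
qed

lemma affine_if_constant_derivative:
  fixes f :: "real \<Rightarrow> 'a::banach"
  assumes cont: "continuous_on {a..b} f"
    and der: "\<And>t. a < t \<Longrightarrow> t < b \<Longrightarrow> (f has_vector_derivative w) (at t)"
    and t: "a \<le> t" "t \<le> b"
  shows "f t = f a + (t - a) *\<^sub>R w"
proof -
  define g where "g s = f s - (s - a) *\<^sub>R w" for s
  have "g t = f a"
  \<comment> \<open>Subtracting the line leaves derivative 0 except possibly at the endpoints, where
    continuity suffices.\<close>
  proof (rule has_derivative_zero_unique_strong_interval[of "{a, b}" a b])
    show "continuous_on {a..b} g"
      unfolding g_def by (intro continuous_intros cont)
    show "(g has_derivative (\<lambda>h. 0)) (at s within {a..b})" if "s \<in> {a..b} - {a, b}" for s
    proof -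
      have "(f has_vector_derivative w) (at s)"
        using der that by auto
      then have "(g has_vector_derivative 0) (at s)"
        unfolding g_def by (auto intro!: derivative_eq_intros)
      then show ?thesis
        using has_derivative_at_withinI by (auto simp: has_vector_derivative_def)
    qed
  qed (use t in \<open>auto simp: g_def\<close>)
  then show ?thesis
    by (simp add: g_def algebra_simps)
qed

section \<open>Contacts and uniqueness of the contact partner\<close>

lemma collide_sym: "collide x t j k \<longleftrightarrow> collide x t k j"
  unfolding collide_def in_contact_def by (auto simp: norm_minus_commute)

lemma in_contact_sym: "in_contact x t j k \<longleftrightarrow> in_contact x t k j"
  unfolding in_contact_def by (auto simp: norm_minus_commute)

lemma collide_in_contact: "collide x t j k \<Longrightarrow> in_contact x t j k"
  unfolding collide_def by simp

text \<open>Two different partners of \<open>j\<close> would form with it a linked collection of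
  three balls.\<close>

lemma in_contact_unique:
  assumes "no_simultaneous_collisions x" "in_contact x t j k" "in_contact x t j l"
  shows "k = l"
proof (rule ccontr)
  assume "k \<noteq> l"
  moreover have "j \<noteq> k" "j \<noteq> l"
    using assms by (auto simp: in_contact_def)
  ultimately have "card {j, k, l} = 3"
    by simp
  moreover have "(in_contact x t)\<^sup>*\<^sup>* p j" "(in_contact x t)\<^sup>*\<^sup>* j p" if "p \<in> {j, k, l}" for p
    using that assms(2,3) in_contact_sym by (metis empty_iff insert_iff r_into_rtranclp rtranclp.rtrancl_refl)+
  then have "\<forall>p\<in>{j, k, l}. \<forall>q\<in>{j, k, l}. (in_contact x t)\<^sup>*\<^sup>* p q"
    by (meson rtranclp_trans)
  ultimately show False
    using assms(1) unfolding no_simultaneous_collisions_def by (metis order_refl)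
qed

section \<open>Local regularity and free flight\<close>

context hard_ball_evolution
begin

lemma continuous_center: "continuous_on S (\<lambda>t. x t $ k)"
  by (intro continuous_intros continuous_on_subset[OF continuous]) auto

lemma vel_after_derivative:
  "((\<lambda>s. x s $ k) has_vector_derivative vel_after x t $ k) (at_right t)"
  using bounded_linear.has_vector_derivative[OF bounded_linear_vec_nth] velocities_exist(2)
  unfolding vel_after_def vector_derivative_works by blast

lemma vel_before_derivative:
  "((\<lambda>s. x s $ k) has_vector_derivative vel_before x t $ k) (at_left t)"
  using bounded_linear.has_vector_derivative[OF bounded_linear_vec_nth] velocities_exist(1)
  unfolding vel_before_def vector_derivative_works by blast

text \<open>A pair apart at \<open>t\<close> has distance above 2 and keeps it for a short time by
  continuity; there are finitely many pairs, so one \<open>e\<close> serves all.\<close>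

lemma contact_nearby:
  "\<exists>e>0. \<forall>s j k. dist s t < e \<longrightarrow> in_contact x s j k \<longrightarrow> in_contact x t j k"
proof -
  have "\<forall>\<^sub>F s in nhds t. in_contact x s j k \<longrightarrow> in_contact x t j k" for j k
  proof (cases "in_contact x t j k \<or> j = k")
    case True
    then show ?thesis by (auto simp: in_contact_def)
  next
    case False
    then have gt: "norm (x t $ j - x t $ k) > 2"
      using no_overlap[of j k t] by (auto simp: in_contact_def)
    have "continuous_on UNIV (\<lambda>s. norm (x s $ j - x s $ k))"
      by (intro continuous_on_norm continuous_on_diff continuous_center)
    then have "((\<lambda>s. norm (x s $ j - x s $ k)) \<longlongrightarrow> norm (x t $ j - x t $ k)) (nhds t)"
      by (simp add: continuous_on_eq_continuous_at tendsto_nhds_iff continuous_at)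
    from order_tendstoD(1)[OF this gt] show ?thesis
      by eventually_elim (auto simp: in_contact_def)
  qed
  then have "\<forall>\<^sub>F s in nhds t. \<forall>j k. in_contact x s j k \<longrightarrow> in_contact x t j k"
    by (intro eventually_all_finite)
  then show ?thesis
    unfolding eventually_nhds_metric by blast
qed

text \<open>Collisions at \<open>a\<close> and \<open>b\<close> themselves are allowed: continuity
  extends the affine formula to the closed interval, and the one-sided derivatives pointing into it
  are read off from that formula.\<close>

lemma free_flight:
  assumes ab: "a < b"
    and free: "\<And>s j. a < s \<Longrightarrow> s < b \<Longrightarrow> \<not> collide x s j k"
  shows "\<And>t. a \<le> t \<Longrightarrow> t \<le> b \<Longrightarrow> x t $ k = x a $ k + (t - a) *\<^sub>R vel_after x a $ k"
    and "\<And>t. a \<le> t \<Longrightarrow> t < b \<Longrightarrow> vel_after x t $ k = vel_after x a $ k"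
    and "\<And>t. a < t \<Longrightarrow> t \<le> b \<Longrightarrow> vel_before x t $ k = vel_after x a $ k"
proof -
  obtain w where w: "\<And>t. a < t \<Longrightarrow> t < b \<Longrightarrow> ((\<lambda>s. x s $ k) has_vector_derivative w) (at t)"
    using velocity_constant[OF ab free] greaterThanLessThan_iff by blast
  have affine: "x t $ k = x a $ k + (t - a) *\<^sub>R w" if "a \<le> t" "t \<le> b" for t
    using affine_if_constant_derivative[OF continuous_center, of a b k w t] w that by blast
  have der: "((\<lambda>s. x s $ k) has_vector_derivative w) (at t within S)" if "t \<in> S" "S \<subseteq> {a..b}" for t S
  proof (rule has_vector_derivative_transform)
    show "x s $ k = x a $ k + (s - a) *\<^sub>R w" if "s \<in> S" for s
      using that \<open>S \<subseteq> {a..b}\<close> by (intro affine) auto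
  qed (use that in \<open>auto intro!: derivative_eq_intros\<close>)
  have after: "vel_after x t $ k = w" if "a \<le> t" "t < b" for t
  proof (rule vector_derivative_unique_within)
    show "((\<lambda>s. x s $ k) has_vector_derivative w) (at_right t)"
      using der[of t "{t..b}"] that by (simp add: at_within_Icc_at_right)
  qed (use vel_after_derivative in auto)
  have before: "vel_before x t $ k = w" if "a < t" "t \<le> b" for t
  proof (rule vector_derivative_unique_within)
    show "((\<lambda>s. x s $ k) has_vector_derivative w) (at_left t)"
      using der[of t "{a..t}"] that by (simp add: at_within_Icc_at_left)
  qed (use vel_before_derivative in auto)
  show "x t $ k = x a $ k + (t - a) *\<^sub>R vel_after x a $ k" if "a \<le> t" "t \<le> b" for t
    using affine[OF that] after[of a] ab by simp
  show "vel_after x t $ k = vel_after x a $ k" if "a \<le> t" "t < b" for t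
    using after[OF that] after[of a] ab by simp
  show "vel_before x t $ k = vel_after x a $ k" if "a < t" "t \<le> b" for t
    using before[OF that] after[of a] ab by simp
qed

section \<open>Effect of a single collision\<close>

text \<open>At contact \<open>norm q = 2\<close>, so the contact direction is \<open>q / 2\<close>
  and the collision law becomes an exchange of the impulse \<open>c *\<^sub>R q\<close>; the
  incoming condition makes \<open>c\<close> positive.\<close>

lemma collision_impulse:
  assumes "collide x t j k"
  defines "q \<equiv> x t $ j - x t $ k"
  obtains c where "c > 0" "q \<bullet> q = 4" "(vel_before x t $ j - vel_before x t $ k) \<bullet> q = - 4 * c"
    "vel_after x t $ j = vel_before x t $ j + c *\<^sub>R q"
    "vel_after x t $ k = vel_before x t $ k - c *\<^sub>R q"
proof
  let ?v = "vel_before x t"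
  let ?c = "- ((?v $ j - ?v $ k) \<bullet> q) / 4"
  have norm: "norm q = 2"
    using assms by (simp add: collide_def in_contact_def)
  then show "q \<bullet> q = 4"
    by (simp add: dot_square_norm)
  have u: "contact_dir x t j k = (1/2) *\<^sub>R q"
    using norm by (simp add: contact_dir_def flip: q_def)
  show "?c > 0"
    using incoming[OF assms(1)] by (simp add: q_def)
  show "(?v $ j - ?v $ k) \<bullet> q = - 4 * ?c"
    by simp
  show "vel_after x t $ j = ?v $ j + ?c *\<^sub>R q"
    unfolding collision_law(1)[OF assms(1)] u
    by (simp add: inner_diff_left algebra_simps diff_divide_distrib)
  show "vel_after x t $ k = ?v $ k - ?c *\<^sub>R q"
    unfolding collision_law(2)[OF assms(1)] u
    by (simp add: inner_diff_left algebra_simps diff_divide_distrib)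
qed

text \<open>The impulse reverses the normal component of the relative velocity:
  \<open>- 4 * c\<close> turns into \<open>- 4 * c + 8 * c\<close>.\<close>

lemma outgoing:
  assumes "collide x t j k"
  shows "(vel_after x t $ j - vel_after x t $ k) \<bullet> (x t $ j - x t $ k) > 0"
proof -
  define q where "q = x t $ j - x t $ k"
  obtain c where c: "c > 0" "q \<bullet> q = 4" "(vel_before x t $ j - vel_before x t $ k) \<bullet> q = - 4 * c"
    and v: "vel_after x t $ j = vel_before x t $ j + c *\<^sub>R q"
      "vel_after x t $ k = vel_before x t $ k - c *\<^sub>R q"
    using collision_impulse[OF assms] unfolding q_def by metis
  have "(vel_after x t $ j - vel_after x t $ k) \<bullet> q
      = (vel_before x t $ j - vel_before x t $ k) \<bullet> q + 2 * c * (q \<bullet> q)"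
    unfolding v by (simp only: inner_diff_left inner_add_left inner_scaleR_left)
  then show ?thesis
    using c by (simp flip: q_def)
qed

section \<open>Isolation of collision times\<close>

text \<open>The squared distance of the pair equals 4 at \<open>t\<close> and, by
  \<open>outgoing\<close>, has a positive right derivative there.\<close>

lemma separation_after_collision:
  assumes "collide x t j k"
  obtains d where "d > 0" "\<And>s. t < s \<Longrightarrow> s < t + d \<Longrightarrow> \<not> in_contact x s j k"
proof -
  define q where "q s = x s $ j - x s $ k" for s
  let ?w = "vel_after x t $ j - vel_after x t $ k"
  have "(q has_vector_derivative ?w) (at_right t)"
    unfolding q_def by (intro derivative_intros vel_after_derivative)
  then have "((\<lambda>s. q s \<bullet> q s) has_real_derivative 2 * (?w \<bullet> q t)) (at_right t)"
    unfolding has_real_derivative_iff_has_vector_derivative has_vector_derivative_def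
    by (auto intro!: derivative_eq_intros simp: inner_commute)
  moreover have "2 * (?w \<bullet> q t) > 0"
    using outgoing[OF assms] by (simp add: q_def)
  ultimately obtain d where d: "d > 0"
    "\<And>h. h > 0 \<Longrightarrow> t + h \<in> {t<..} \<Longrightarrow> h < d \<Longrightarrow> q t \<bullet> q t < q (t + h) \<bullet> q (t + h)"
    using has_real_derivative_pos_inc_right by blast
  show thesis
  proof
    show "\<not> in_contact x s j k" if "t < s" "s < t + d" for s
      using d(2)[of "s - t"] that assms
      by (auto simp: collide_def in_contact_def q_def dot_square_norm)
  qed (rule d(1))
qed

text \<open>
  As long as no third ball comes near, the squared distance of the pair is a quadratic function
  with positive initial slope.
\<close>

lemma no_contact_after_collision:
  assumes nsim: "no_simultaneous_collisions x"
    and near: "\<And>r i l. s1 \<le> r \<Longrightarrow> r \<le> s2 \<Longrightarrow> in_contact x r i l \<Longrightarrow> in_contact x t i l"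
    and s: "s1 < s2" and col: "collide x s1 j k"
  shows "\<not> in_contact x s2 j k"
proof
  assume c2: "in_contact x s2 j k"
  have jk: "j \<noteq> k" "in_contact x t j k" "in_contact x t k j"
    using near[of s1 j k] col s in_contact_sym[of x t j k] by (auto simp: collide_def in_contact_def)
  obtain d where d: "d > 0" "\<And>r. s1 < r \<Longrightarrow> r < s1 + d \<Longrightarrow> \<not> in_contact x r j k"
    using separation_after_collision[OF col] by blast
  \<comment> \<open>The least element \<open>m\<close> of \<open>C\<close> is the first contact of
    the pair after \<open>s1\<close>: the choice of \<open>d\<close> excludes earlier ones.\<close>
  define C where "C = {r \<in> {s1 + d..s2}. norm (x r $ j - x r $ k) = 2}"
  have s2C: "s2 \<in> C"
    using d(2)[of s2] c2 s by (force simp: C_def in_contact_def)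
  have "closed C"
    unfolding C_def
    by (intro continuous_closed_preimage_constant continuous_on_norm continuous_on_diff
        continuous_center) auto
  then have "compact C"
    unfolding compact_eq_bounded_closed C_def
    by (auto intro: bounded_subset[of "{s1 + d..s2}"])
  then obtain m where m: "m \<in> C" "\<And>r. r \<in> C \<Longrightarrow> m \<le> r"
    using compact_attains_inf[of C] s2C by blast
  have sm: "s1 < m" "m \<le> s2"
    using m d(1) by (auto simp: C_def)
  have nocontact: "\<not> in_contact x r j k" if "s1 < r" "r < m" for r
  proof (cases "r < s1 + d")
    case False
    then show ?thesis
      using m(2)[of r] that sm by (force simp: C_def in_contact_def)
  qed (use d that in auto)
  \<comment> \<open>A collision involving \<open>j\<close> or \<open>k\<close> before
    \<open>m\<close> would be a contact already present at \<open>t\<close>, where these two touch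
    only each other; but they do not touch before \<open>m\<close>.\<close>
  have free: "\<not> collide x r i l" if "s1 < r" "r < m" "l = j \<or> l = k" for r i l
  proof
    assume "collide x r i l"
    then have c: "in_contact x r l i"
      using collide_in_contact in_contact_sym by blast
    then have "in_contact x t l i"
      using near[of r l i] that sm by simp
    then have "l = j \<and> i = k \<or> l = k \<and> i = j"
      using that(3) jk in_contact_unique[OF nsim] by metis
    then show False
      using c nocontact[of r] that in_contact_sym by metis
  qed
  define q where "q = x s1 $ j - x s1 $ k"
  define w where "w = vel_after x s1 $ j - vel_after x s1 $ k"
  have "x m $ j - x m $ k = q + (m - s1) *\<^sub>R w"
    using free_flight(1)[OF sm(1) free, of j m] free_flight(1)[OF sm(1) free, of k m] sm
    by (simp add: q_def w_def algebra_simps)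
  moreover have "(q + e *\<^sub>R w) \<bullet> (q + e *\<^sub>R w) = q \<bullet> q + 2 * e * (w \<bullet> q) + e\<^sup>2 * (w \<bullet> w)" for e
    by (simp add: algebra_simps inner_commute power2_eq_square)
  moreover have "q \<bullet> q = 4" "(x m $ j - x m $ k) \<bullet> (x m $ j - x m $ k) = 4"
    using col m(1) by (auto simp: collide_def in_contact_def q_def C_def dot_square_norm)
  moreover have "2 * (m - s1) * (w \<bullet> q) > 0" "(m - s1)\<^sup>2 * (w \<bullet> w) \<ge> 0"
    using outgoing[OF col] sm by (simp_all add: q_def w_def)
  ultimately show False
    by simp
qed

text \<open>Close to \<open>t\<close> only pairs touching at \<open>t\<close> can touch, so no pair
  collides twice there. Hence there are finitely many collision times nearby, and those other than
  \<open>t\<close> keep a positive distance from it.\<close>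

lemma collisions_isolated:
  assumes nsim: "no_simultaneous_collisions x"
  obtains e where "e > 0" "\<And>s j k. s \<noteq> t \<Longrightarrow> dist s t < e \<Longrightarrow> \<not> collide x s j k"
proof -
  obtain e where e: "e > 0" "\<And>s j k. dist s t < e \<Longrightarrow> in_contact x s j k \<Longrightarrow> in_contact x t j k"
    using contact_nearby by metis
  define Z where "Z j k = {s. dist s t < e \<and> collide x s j k}" for j k
  have once: "\<not> s1 < s2" if "s1 \<in> Z j k" "s2 \<in> Z j k" for s1 s2 j k
  proof
    assume "s1 < s2"
    have "in_contact x t i l" if "s1 \<le> r" "r \<le> s2" "in_contact x r i l" for r i l
      using that \<open>s1 \<in> Z j k\<close> \<open>s2 \<in> Z j k\<close> e(2)[of r i l] by (auto simp: Z_def dist_real_def)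
    then have "\<not> in_contact x s2 j k"
      using no_contact_after_collision[OF nsim _ \<open>s1 < s2\<close>, of t j k] that by (auto simp: Z_def)
    then show False
      using that collide_in_contact by (auto simp: Z_def)
  qed
  have "finite (Z j k)" for j k
  proof (cases "Z j k = {}")
    case False
    then obtain s where "s \<in> Z j k" by blast
    then have "Z j k \<subseteq> {s}"
      using once by (metis insertI1 linorder_neqE_linordered_idom subsetI)
    then show ?thesis
      by (rule finite_subset) simp
  qed simp
  then have "finite (\<Union>j k. Z j k)"
    by simp
  then obtain d where d: "d > 0" "\<And>s. s \<in> (\<Union>j k. Z j k) \<Longrightarrow> s \<noteq> t \<Longrightarrow> d \<le> dist t s"
    using finite_set_avoid[of "\<Union>j k. Z j k" t] by blast
  show thesis
  proof
    show "min d e > 0"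
      using d(1) e(1) by simp
    show "\<not> collide x s j k" if "s \<noteq> t" "dist s t < min d e" for s j k
      using d(2)[of s] that by (force simp: Z_def dist_commute)
  qed
qed


section \<open>Conservation laws across an instant\<close>

text \<open>Isolation gives an open interval around \<open>t\<close> on which \<open>k\<close> has
  no collision at all, so \<open>t\<close> lies inside a free flight.\<close>

lemma vel_unchanged:
  assumes nsim: "no_simultaneous_collisions x" and "\<And>j. \<not> collide x t k j"
  shows "vel_after x t $ k = vel_before x t $ k"
proof -
  obtain e where e: "e > 0" "\<And>s j k. s \<noteq> t \<Longrightarrow> dist s t < e \<Longrightarrow> \<not> collide x s j k"
    using collisions_isolated[OF nsim, of t] by blast
  have free: "\<not> collide x s j k" if "t - e < s" "s < t + e" for s j
    using e(2)[of s j k] that assms(2)[of j] collide_sym[of x t j k]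
    by (cases "s = t") (auto simp: dist_real_def)
  show ?thesis
    using free_flight(2,3)[of "t - e" "t + e" k t] free e(1) by simp
qed

lemma jump:
  assumes nsim: "no_simultaneous_collisions x"
  shows "(\<Sum>k\<in>UNIV. vel_after x t $ k) = (\<Sum>k\<in>UNIV. vel_before x t $ k)"
    and "vel_after x t \<bullet> vel_after x t = vel_before x t \<bullet> vel_before x t"
    and "x t \<bullet> vel_before x t \<le> x t \<bullet> vel_after x t"
proof -
  \<comment> \<open>\<open>\<sigma>\<close> swaps collision partners at \<open>t\<close> and fixes
    all other balls. Partners are unique, so it is an involution and everything can be checked pair
    by pair.\<close>
  define \<sigma> where "\<sigma> k = (if \<exists>j. collide x t k j then SOME j. collide x t k j else k)" for k
  let ?u = "vel_before x t" and ?v = "vel_after x t"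
  have uniq: "j = l" if "collide x t k j" "collide x t k l" for j k l
    using that in_contact_unique[OF nsim] collide_in_contact by blast
  have \<sigma>: "\<sigma> k = j" if "collide x t k j" for j k
    using that uniq unfolding \<sigma>_def by (metis someI)
  have \<sigma>_cases: "(\<exists>j. collide x t k j \<and> \<sigma> k = j \<and> \<sigma> j = k) \<or> \<sigma> k = k \<and> ?v $ k = ?u $ k" for k
  proof (cases "\<exists>j. collide x t k j")
    case True
    then show ?thesis using \<sigma> collide_sym by metis
  next
    case False
    then show ?thesis using vel_unchanged[OF nsim, of t k] by (auto simp: \<sigma>_def)
  qed
  then have inv: "\<sigma> (\<sigma> k) = k" for k
    by metis
  have pair: "?v $ k + ?v $ \<sigma> k = ?u $ k + ?u $ \<sigma> k
      \<and> ?v $ k \<bullet> ?v $ k + ?v $ \<sigma> k \<bullet> ?v $ \<sigma> k = ?u $ k \<bullet> ?u $ k + ?u $ \<sigma> k \<bullet> ?u $ \<sigma> k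
      \<and> x t $ k \<bullet> ?u $ k + x t $ \<sigma> k \<bullet> ?u $ \<sigma> k \<le> x t $ k \<bullet> ?v $ k + x t $ \<sigma> k \<bullet> ?v $ \<sigma> k" for k
    using \<sigma>_cases[of k]
  proof (elim disjE exE conjE)
    fix j
    assume col: "collide x t k j" and \<sigma>k: "\<sigma> k = j"
    define q where "q = x t $ k - x t $ j"
    obtain c where c: "c > 0" "q \<bullet> q = 4" "(?u $ k - ?u $ j) \<bullet> q = - 4 * c"
      and v: "?v $ k = ?u $ k + c *\<^sub>R q" "?v $ j = ?u $ j - c *\<^sub>R q"
      using collision_impulse[OF col] unfolding q_def by metis
    \<comment> \<open>The two correction terms are \<open>- 8 * c\<^sup>2\<close> and
      \<open>8 * c\<^sup>2\<close> and cancel.\<close>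
    have "?v $ k \<bullet> ?v $ k + ?v $ j \<bullet> ?v $ j
        = ?u $ k \<bullet> ?u $ k + ?u $ j \<bullet> ?u $ j + 2 * c * ((?u $ k - ?u $ j) \<bullet> q) + 2 * c\<^sup>2 * (q \<bullet> q)"
      unfolding v
      by (simp add: inner_add_left inner_add_right inner_diff_left inner_diff_right
          inner_commute power2_eq_square algebra_simps)
    \<comment> \<open>The gain is \<open>4 * c\<close>, because the impulse pushes the balls apart
      along \<open>q\<close>.\<close>
    moreover have "x t $ k \<bullet> ?v $ k + x t $ j \<bullet> ?v $ j
        = x t $ k \<bullet> ?u $ k + x t $ j \<bullet> ?u $ j + c * (q \<bullet> q)"
      unfolding v by (simp add: inner_add_right inner_diff_right inner_diff_left q_def algebra_simps)
    ultimately show ?thesis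
      using c by (simp add: \<sigma>k v power2_eq_square)
  qed auto
  have inner: "a \<bullet> b = (\<Sum>k\<in>UNIV. a $ k \<bullet> b $ k)" for a b :: "real^'d^'n"
    by (rule inner_vec_def)
  show "(\<Sum>k\<in>UNIV. ?v $ k) = (\<Sum>k\<in>UNIV. ?u $ k)"
    by (rule sum_involution_eq[of \<sigma>]) (use inv pair in auto)
  show "?v \<bullet> ?v = ?u \<bullet> ?u"
    unfolding inner by (rule sum_involution_eq[of \<sigma>]) (use inv pair in auto)
  show "x t \<bullet> ?u \<le> x t \<bullet> ?v"
    unfolding inner by (rule sum_involution_le[of \<sigma>]) (use inv pair in auto)
qed

section \<open>Growth of position over long time intervals\<close>

text \<open>
  All clauses are preserved when two adjacent time intervals are joined, so they only need to be
  checked on intervals that are free of collisions except at their endpoints.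
\<close>

definition evolves :: "real \<Rightarrow> real \<Rightarrow> bool" where
  "evolves a b \<longleftrightarrow>
     (\<Sum>k\<in>UNIV. vel_after x b $ k) = (\<Sum>k\<in>UNIV. vel_after x a $ k)
   \<and> (\<Sum>k\<in>UNIV. x b $ k) = (\<Sum>k\<in>UNIV. x a $ k) + (b - a) *\<^sub>R (\<Sum>k\<in>UNIV. vel_after x a $ k)
   \<and> vel_after x b \<bullet> vel_after x b = vel_after x a \<bullet> vel_after x a
   \<and> norm (x b - x a) \<le> (b - a) * norm (vel_after x a)
   \<and> x b \<bullet> vel_after x b \<ge> x a \<bullet> vel_after x a + (b - a) * (vel_after x a \<bullet> vel_after x a)
   \<and> x b \<bullet> x b \<ge> x a \<bullet> x a + 2 * (b - a) * (x a \<bullet> vel_after x a)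
       + (b - a)\<^sup>2 * (vel_after x a \<bullet> vel_after x a)"

text \<open>Up to \<open>b\<close> the clauses hold with equality for the velocity
  \<open>vel_after x a\<close>. A collision at \<open>a\<close> is already contained in that
  velocity, and one at \<open>b\<close> is handled by \<open>jump\<close>, which can only raise
  \<open>x \<bullet> v\<close>.\<close>

lemma evolves_free_flight:
  assumes nsim: "no_simultaneous_collisions x"
    and "a \<le> b" and free: "\<And>s j k. a < s \<Longrightarrow> s < b \<Longrightarrow> \<not> collide x s j k"
  shows "evolves a b"
proof (cases "a = b")
  case True
  then show ?thesis by (simp add: evolves_def)
next
  case False
  then have ab: "a < b" using assms by simp
  let ?v = "vel_after x a"
  have xb: "x b = x a + (b - a) *\<^sub>R ?v"
    using free_flight(1)[OF ab free order.strict_implies_order[OF ab] order_refl] by (simp add: vec_eq_iff)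
  have vb: "vel_before x b = ?v"
    using free_flight(3)[OF ab free ab order_refl] by (simp add: vec_eq_iff)
  have "x b \<bullet> ?v \<le> x b \<bullet> vel_after x b" "vel_after x b \<bullet> vel_after x b = ?v \<bullet> ?v"
    "(\<Sum>k\<in>UNIV. vel_after x b $ k) = (\<Sum>k\<in>UNIV. ?v $ k)"
    using jump[OF nsim, of b] unfolding vb by auto
  moreover have "x b \<bullet> ?v = x a \<bullet> ?v + (b - a) * (?v \<bullet> ?v)"
    unfolding xb by (simp add: inner_add_left)
  moreover have "x b \<bullet> x b = x a \<bullet> x a + 2 * (b - a) * (x a \<bullet> ?v) + (b - a)\<^sup>2 * (?v \<bullet> ?v)"
    unfolding xb
    by (simp add: inner_add_left inner_add_right inner_commute power2_eq_square algebra_simps)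
  moreover have "norm (x b - x a) = (b - a) * norm ?v"
    using ab by (simp add: xb)
  moreover have "(\<Sum>k\<in>UNIV. x b $ k) = (\<Sum>k\<in>UNIV. x a $ k) + (b - a) *\<^sub>R (\<Sum>k\<in>UNIV. ?v $ k)"
    by (simp add: xb sum.distrib scaleR_sum_right)
  ultimately show ?thesis
    unfolding evolves_def by simp
qed

lemma evolves_trans:
  assumes ab: "evolves a b" and bc: "evolves b c" and le: "a \<le> b" "b \<le> c"
  shows "evolves a c"
proof -
  let ?v = "vel_after x"
  note ab = ab[unfolded evolves_def] and bc = bc[unfolded evolves_def]
  have E: "?v b \<bullet> ?v b = ?v a \<bullet> ?v a" "norm (?v b) = norm (?v a)"
    using ab by (auto simp: norm_eq_sqrt_inner)
  have "norm (x c - x a) \<le> norm (x c - x b) + norm (x b - x a)"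
    by (rule norm_diff_triangle_ineq[of "x c" "x b" "x b" "x a", simplified]) 
  also have "\<dots> \<le> (c - a) * norm (?v a)"
    using ab bc E by (simp add: algebra_simps)
  finally have 1: "norm (x c - x a) \<le> (c - a) * norm (?v a)" .
  have 2: "(\<Sum>k\<in>UNIV. x c $ k) = (\<Sum>k\<in>UNIV. x a $ k) + (c - a) *\<^sub>R (\<Sum>k\<in>UNIV. ?v a $ k)"
    using ab bc by (simp add: add.assoc flip: scaleR_add_left)
  have g: "x b \<bullet> ?v b \<ge> x a \<bullet> ?v a + (b - a) * (?v a \<bullet> ?v a)"
    using ab by simp
  have 3: "x c \<bullet> ?v c \<ge> x a \<bullet> ?v a + (c - a) * (?v a \<bullet> ?v a)"
    using g bc E by (simp add: algebra_simps)
  \<comment> \<open>The slope at \<open>b\<close> has grown by \<open>b - a\<close> times the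
    squared speed; this supplies the cross term in the expansion of
    \<open>(c - a)\<^sup>2\<close>.\<close>
  have "2 * (c - b) * (x b \<bullet> ?v b) \<ge> 2 * (c - b) * (x a \<bullet> ?v a + (b - a) * (?v a \<bullet> ?v a))"
    using g le by (intro mult_left_mono) auto
  then have 4: "x c \<bullet> x c \<ge> x a \<bullet> x a + 2 * (c - a) * (x a \<bullet> ?v a) + (c - a)\<^sup>2 * (?v a \<bullet> ?v a)"
    using ab bc E by (simp add: power2_eq_square algebra_simps)
  show ?thesis
    unfolding evolves_def using ab bc 1 2 3 4 by simp
qed

text \<open>Bisection principle: a relation that passes to joined intervals and holds on all short
  intervals around each point holds on every interval.\<close>

lemma evolves:
  assumes nsim: "no_simultaneous_collisions x" and "a \<le> b"
  shows "evolves a b"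
proof (rule Bolzano[OF \<open>a \<le> b\<close>, of evolves])
  show "evolves a c" if "evolves a b" "evolves b c" "a \<le> b" "b \<le> c" for a b c
    using that by (rule evolves_trans)
next
  fix t
  obtain e where e: "e > 0" "\<And>s j k. s \<noteq> t \<Longrightarrow> dist s t < e \<Longrightarrow> \<not> collide x s j k"
    using collisions_isolated[OF nsim, of t] by blast
  \<comment> \<open>Cutting at \<open>t\<close> turns a possible collision at \<open>t\<close> into
    an endpoint collision of two free flights.\<close>
  have "evolves a b" if "a \<le> t" "t \<le> b" "b - a < e" for a b
  proof (rule evolves_trans[of a t b])
    show "evolves a t"
    proof (rule evolves_free_flight[OF nsim \<open>a \<le> t\<close>])
      show "\<not> collide x s j k" if "a < s" "s < t" for s j k
        using that \<open>t \<le> b\<close> \<open>b - a < e\<close> by (intro e(2)) (auto simp: dist_real_def)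
    qed
    show "evolves t b"
    proof (rule evolves_free_flight[OF nsim \<open>t \<le> b\<close>])
      show "\<not> collide x s j k" if "t < s" "s < b" for s j k
        using that \<open>a \<le> t\<close> \<open>b - a < e\<close> by (intro e(2)) (auto simp: dist_real_def)
    qed
  qed (use that in auto)
  then show "\<exists>d>0. \<forall>a b. a \<le> t \<and> t \<le> b \<and> b - a < d \<longrightarrow> evolves a b"
    using e(1) by (intro exI[of _ e]) simp
qed

end

section \<open>Splitting a finite family of vectors; stability of directions\<close>

text \<open>The right side of \<open>spread\<close> is the sum of squared distances to the centroid.
  Without a gap all points lie within \<open>(n - 1) * \<delta>\<close> of one of them, where
  \<open>n\<close> is their number, which makes that sum too small.\<close>

lemma exists_gap:
  fixes w :: "'n::finite \<Rightarrow> 'a::real_inner" and \<delta> :: real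
  assumes spread: "(real CARD('n) - 1) ^ 3 * \<delta>\<^sup>2
      < (\<Sum>k\<in>UNIV. (norm (w k))\<^sup>2) - (norm (\<Sum>k\<in>UNIV. w k))\<^sup>2 / real CARD('n)"
    and \<delta>: "\<delta> \<ge> 0"
  obtains A where "A \<noteq> {}" "- A \<noteq> {}" "\<And>j k. j \<in> A \<Longrightarrow> k \<notin> A \<Longrightarrow> norm (w k - w j) > \<delta>"
proof (rule ccontr)
  note gap = that
  let ?n = "real CARD('n)"
  assume "\<not> thesis"
  then have nogap: "\<exists>j\<in>S. \<exists>k. k \<notin> S \<and> norm (w k - w j) \<le> \<delta>"
    if ne: "S \<noteq> {}" "- S \<noteq> {}" for S
    using gap[of S] \<open>\<not> thesis\<close> ne by (meson not_le)
  fix i :: 'n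
  \<comment> \<open>Without a gap, a cluster around \<open>i\<close> grows by one element for each \<open>\<delta>\<close> of radius.\<close>
  have "\<exists>S. i \<in> S \<and> card S = Suc m \<and> (\<forall>k\<in>S. norm (w k - w i) \<le> real m * \<delta>)" if "m < CARD('n)" for m
    using that
  proof (induction m)
    case 0
    show ?case by (intro exI[of _ "{i}"]) simp
  next
    case (Suc m)
    then obtain S where S: "i \<in> S" "card S = Suc m" "\<And>k. k \<in> S \<Longrightarrow> norm (w k - w i) \<le> real m * \<delta>"
      by auto
    moreover have "- S \<noteq> {}"
      using S(2) Suc.prems by (metis Compl_empty_eq boolean_algebra_class.boolean_algebra.double_compl less_irrefl)
    ultimately obtain j k where jk: "j \<in> S" "k \<notin> S" "norm (w k - w j) \<le> \<delta>"
      using nogap[of S] by blast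
    have "norm (w k - w i) \<le> norm (w k - w j) + norm (w j - w i)"
      using norm_triangle_ineq[of "w k - w j" "w j - w i"] by simp
    then have "norm (w k - w i) \<le> real (Suc m) * \<delta>"
      using jk S(3)[of j] by (simp add: algebra_simps)
    moreover have "norm (w l - w i) \<le> real (Suc m) * \<delta>" if "l \<in> S" for l
      using S(3)[OF that] \<delta> by (simp add: algebra_simps)
    ultimately show ?case
      using S jk by (intro exI[of _ "insert k S"]) (auto simp: card_insert_if)
  qed
  from this[of "CARD('n) - 1"] obtain S where
    S: "card S = CARD('n)" "\<And>k. k \<in> S \<Longrightarrow> norm (w k - w i) \<le> (?n - 1) * \<delta>"
    by (auto simp: of_nat_diff Suc_leI)
  have "S = UNIV"
    using S(1) by (simp add: card_eq_UNIV_imp_eq_UNIV)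
  then have near: "(norm (w k - w i))\<^sup>2 \<le> ((?n - 1) * \<delta>)\<^sup>2" for k
    using S(2)[of k] by (intro power_mono) auto
  let ?s = "\<Sum>k\<in>UNIV. w k"
  have dist: "(norm (w k - w i))\<^sup>2 = (norm (w k))\<^sup>2 - 2 * (w k \<bullet> w i) + (norm (w i))\<^sup>2" for k
    by (simp add: power2_norm_eq_inner inner_diff_left inner_diff_right inner_commute)
  have "(\<Sum>k\<in>UNIV. (norm (w k - w i))\<^sup>2) = (\<Sum>k\<in>UNIV. (norm (w k))\<^sup>2) - 2 * (?s \<bullet> w i) + ?n * (norm (w i))\<^sup>2"
    by (simp add: dist sum.distrib sum_subtractf inner_sum_left sum_distrib_left)
  \<comment> \<open>Completing the square: the squared distances to \<open>w i\<close> exceed those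
    to the centroid by this term in total.\<close>
  moreover have "(norm ?s)\<^sup>2 / ?n - 2 * (?s \<bullet> w i) + ?n * (norm (w i))\<^sup>2 = ?n * (norm (w i - ?s /\<^sub>R ?n))\<^sup>2"
    by (simp add: power2_norm_eq_inner inner_diff_left inner_diff_right inner_commute
        field_simps)
  moreover have "?n * (norm (w i - ?s /\<^sub>R ?n))\<^sup>2 \<ge> 0"
    by simp
  \<comment> \<open>The term of \<open>i\<close> itself vanishes. The \<open>?n - 1\<close>
    remaining terms have a bound containing \<open>(?n - 1)\<^sup>2\<close>, hence the cube.\<close>
  moreover have "(\<Sum>k\<in>UNIV. (norm (w k - w i))\<^sup>2) = (\<Sum>k\<in>UNIV-{i}. (norm (w k - w i))\<^sup>2)"
    by (simp add: sum.remove[of UNIV i])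
  moreover have "\<dots> \<le> (\<Sum>k\<in>UNIV-{i}. ((?n - 1) * \<delta>)\<^sup>2)"
    by (intro sum_mono near)
  moreover have "\<dots> = (?n - 1) ^ 3 * \<delta>\<^sup>2"
    by (simp add: card_Diff_singleton of_nat_diff Suc_leI power2_eq_square power3_eq_cube)
  ultimately show False
    using spread by simp
qed

text \<open>\<open>y\<close> and \<open>z\<close> stand for the positions at times \<open>T\<close>
  and \<open>t\<close>. Polarization bounds \<open>z \<bullet> y\<close> below by nearly
  \<open>t * T\<close>, so the rescaled vectors are almost equal.\<close>

lemma direction_change:
  fixes y z :: "'a::real_inner"
  assumes r: "0 \<le> r" "r \<le> T" "T \<le> t" "0 < T"
    and y: "T - r \<le> norm y" "norm y \<le> T + r"
    and z: "t - r \<le> norm z" "norm z \<le> t + r"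
    and yz: "norm (z - y) \<le> t - T"
  shows "(norm (z /\<^sub>R t - y /\<^sub>R T))\<^sup>2 \<le> 8 * (r / T) + (r / T)\<^sup>2"
proof -
  define \<eta> \<beta> where "\<eta> = r / T" and "\<beta> = r / t"
  have t: "0 < t" using r by simp
  have \<beta>: "0 \<le> \<beta>" "\<beta> \<le> \<eta>"
    using r t by (auto simp: \<eta>_def \<beta>_def frac_le)
  have fac: "t - r = (1 - \<beta>) * t" "T - r = (1 - \<eta>) * T" "t + r = (1 + \<beta>) * t" "T + r = (1 + \<eta>) * T"
    using r t by (simp_all add: \<eta>_def \<beta>_def field_simps)
  \<comment> \<open>Squaring the lower bounds is legitimate since \<open>r \<le> T \<le> t\<close>
    makes them nonnegative.\<close>
  have sq: "(norm (z - y))\<^sup>2 \<le> (t - T)\<^sup>2" "(T - r)\<^sup>2 \<le> (norm y)\<^sup>2" "(t - r)\<^sup>2 \<le> (norm z)\<^sup>2"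
    "(norm y)\<^sup>2 \<le> (T + r)\<^sup>2" "(norm z)\<^sup>2 \<le> (t + r)\<^sup>2"
    using assms by (auto intro!: power_mono)
  have "(norm (z - y))\<^sup>2 = (norm z)\<^sup>2 + (norm y)\<^sup>2 - 2 * (z \<bullet> y)"
    by (simp add: power2_norm_eq_inner inner_diff_left inner_diff_right inner_commute)
  moreover have "(t - r)\<^sup>2 + (T - r)\<^sup>2 - (t - T)\<^sup>2 = 2 * ((t - r) * (T - r))"
    by (simp add: power2_eq_square algebra_simps)
  ultimately have "z \<bullet> y \<ge> (t - r) * (T - r)"
    using sq by linarith
  moreover have "(t - r) * (T - r) = (1 - \<beta>) * (1 - \<eta>) * (t * T)"
    unfolding fac by (simp add: mult.assoc mult.left_commute)
  ultimately have zy: "(z \<bullet> y) / (t * T) \<ge> (1 - \<beta>) * (1 - \<eta>)"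
    using t r by (simp add: pos_le_divide_eq)
  have "(t + r)\<^sup>2 = (1 + \<beta>)\<^sup>2 * t\<^sup>2" "(T + r)\<^sup>2 = (1 + \<eta>)\<^sup>2 * T\<^sup>2"
    unfolding fac by (simp_all add: power_mult_distrib)
  then have zz: "(norm z)\<^sup>2 / t\<^sup>2 \<le> (1 + \<beta>)\<^sup>2" and yy: "(norm y)\<^sup>2 / T\<^sup>2 \<le> (1 + \<eta>)\<^sup>2"
    using sq t r by (simp_all add: pos_divide_le_eq)
  have "(norm (z /\<^sub>R t - y /\<^sub>R T))\<^sup>2 = (norm z)\<^sup>2 / t\<^sup>2 + (norm y)\<^sup>2 / T\<^sup>2 - 2 * ((z \<bullet> y) / (t * T))"
    by (simp only: power2_norm_eq_inner inner_diff_left inner_diff_right inner_scaleR_left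
        inner_scaleR_right, simp add: inner_commute[of y z] power2_eq_square divide_simps,
        simp add: algebra_simps)
  also have "\<dots> \<le> (1 + \<beta>)\<^sup>2 + (1 + \<eta>)\<^sup>2 - 2 * ((1 - \<beta>) * (1 - \<eta>))"
    using zz yy zy by simp
  \<comment> \<open>The last summand is nonpositive because
    \<open>\<beta> \<le> \<eta>\<close>.\<close>
  also have "\<dots> = 4 * \<eta> + 4 * \<beta> + \<eta>\<^sup>2 + \<beta> * (\<beta> - 2 * \<eta>)"
    by (simp add: power2_eq_square algebra_simps)
  also have "\<dots> \<le> 8 * \<eta> + \<eta>\<^sup>2"
    using \<beta> mult_nonneg_nonpos[of \<beta> "\<beta> - 2 * \<eta>"] by simp
  finally show ?thesis
    by (simp add: \<eta>_def)
qed


section \<open>Choice of the partition and exclusion of late contacts\<close>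

theorem theorem1p1:
  fixes x :: "real \<Rightarrow> real^'d^'n"
  assumes "CARD('n) \<ge> 3"
    and "CARD('d) \<ge> 2"
    and "hard_ball_evolution x"
    and "no_simultaneous_collisions x"
    and "total_momentum x 0 = 0"
    and "total_energy x 0 = 1"
  shows "\<exists>A B. A \<noteq> {} \<and> B \<noteq> {} \<and> A \<inter> B = {} \<and> A \<union> B = (UNIV :: 'n set) \<and>
           (\<forall>t > 100 * real CARD('n) ^ 3 * norm (x 0).
              \<forall>j\<in>A. \<forall>k\<in>B. \<not> collide x t j k)"
proof -
  interpret hard_ball_evolution x by fact
  define n where "n = real CARD('n)"
  define r where "r = norm (x 0)"
  define T where "T = 100 * n ^ 3 * r"
  define \<eta> where "\<eta> = r / T"
  have n: "n \<ge> 3"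
    using assms(1) by (simp add: n_def)
  then have n3: "n ^ 3 \<ge> 27"
    using power_mono[of 3 n 3] by simp
  have sq_vec: "(norm a)\<^sup>2 = (\<Sum>k\<in>UNIV. (norm (a $ k))\<^sup>2)" for a :: "real^'d^'n"
    by (simp add: power2_norm_eq_inner inner_vec_def)
  \<comment> \<open>Transfers bounds on the whole configuration to the difference of two
    balls.\<close>
  have pair_le: "(norm (a $ j - a $ k))\<^sup>2 \<le> 2 * (norm a)\<^sup>2" if "j \<noteq> k" for a :: "real^'d^'n" and j k
  proof -
    have "(norm (a $ j - a $ k))\<^sup>2 \<le> 2 * ((norm (a $ j))\<^sup>2 + (norm (a $ k))\<^sup>2)"
      using zero_le_power2[of "norm (a $ j + a $ k)"]
      by (simp add: power2_norm_eq_inner inner_diff_left inner_diff_right inner_add_left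
          inner_add_right inner_commute)
    also have "(norm (a $ j))\<^sup>2 + (norm (a $ k))\<^sup>2 = (\<Sum>i\<in>{j, k}. (norm (a $ i))\<^sup>2)"
      using that by simp
    also have "\<dots> \<le> (\<Sum>i\<in>UNIV. (norm (a $ i))\<^sup>2)"
      by (intro sum_mono2) auto
    finally show ?thesis by (simp add: sq_vec)
  qed
  obtain i1 i2 :: 'n where "i1 \<noteq> i2"
    using card_le_Suc0_iff_eq[of "UNIV :: 'n set"] assms(1) by auto
  \<comment> \<open>Non-overlap at time 0 keeps \<open>r\<close> away from 0. This makes
    \<open>T\<close> positive and later absorbs the ball diameter into \<open>r\<close>.\<close>
  have "4 \<le> (norm (x 0 $ i1 - x 0 $ i2))\<^sup>2"
    using power_mono[OF no_overlap[OF \<open>i1 \<noteq> i2\<close>, of 0], of 2] by simp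
  then have r2: "r\<^sup>2 \<ge> 2"
    using pair_le[OF \<open>i1 \<noteq> i2\<close>, of "x 0"] by (simp add: r_def)
  then have r: "r > 0"
    unfolding r_def by (metis norm_eq_zero power_zero_numeral not_numeral_le_zero zero_less_norm_iff)
  have T: "T > 0" "r \<le> T"
    using r n3 n by (auto simp: T_def)
  have \<eta>: "\<eta> = 1 / (100 * n ^ 3)" "0 < \<eta>"
    using r n3 n by (auto simp: \<eta>_def T_def)
  have \<eta>_le: "\<eta> \<le> 1 / 2700"
    unfolding \<eta>(1) using n3 by (intro frac_le) auto
  have v: "vel_after x 0 \<bullet> vel_after x 0 = 1" "(\<Sum>k\<in>UNIV. vel_after x 0 $ k) = 0"
    using assms(5,6) sq_vec[of "vel_after x 0"]
    by (auto simp: total_energy_def total_momentum_def power2_norm_eq_inner)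
  have v1: "norm (vel_after x 0) = 1"
    using v by (simp add: norm_eq_sqrt_inner)
  note ev = evolves[OF assms(4), unfolded evolves_def]
  have upper: "norm (x t) \<le> t + r" if "0 \<le> t" for t
    using ev[OF that] v1 norm_triangle_ineq2[of "x t" "x 0"] by (simp add: r_def)
  \<comment> \<open>With \<open>x 0 \<bullet> vel_after x 0 \<ge> - r\<close> the quadratic lower
    bound for the squared norm becomes the perfect square \<open>(t - r)\<^sup>2\<close>.\<close>
  have lower: "t - r \<le> norm (x t)" if "0 \<le> t" for t
  proof (rule power2_le_imp_le)
    have "\<bar>x 0 \<bullet> vel_after x 0\<bar> \<le> r"
      using Cauchy_Schwarz_ineq2[of "x 0" "vel_after x 0"] v1 by (simp add: r_def)
    then have "2 * t * (x 0 \<bullet> vel_after x 0) \<ge> 2 * t * (- r)"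
      using that by (intro mult_left_mono) auto
    moreover have "x 0 \<bullet> x 0 + 2 * t * (x 0 \<bullet> vel_after x 0) + t\<^sup>2 \<le> x t \<bullet> x t"
      using ev[OF that] v by simp
    ultimately show "(t - r)\<^sup>2 \<le> (norm (x t))\<^sup>2"
      by (simp add: r_def power2_norm_eq_inner power2_diff)
  qed simp
  have speed: "norm (x t - x T) \<le> t - T" if "T \<le> t" for t
  proof -
    have "norm (vel_after x T) = 1"
      using ev[of 0 T] T v by (simp add: norm_eq_sqrt_inner)
    then show ?thesis
      using ev[OF that] by simp
  qed
  define w where "w = x T /\<^sub>R T"
  \<comment> \<open>Small enough that \<open>(n - 1) ^ 3 * \<delta>\<^sup>2 \<le> 1 / 2\<close>,
    below the spread of at least \<open>1 - 2 * \<eta>\<close>; large enough that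
    \<open>\<delta>\<^sup>2\<close> exceeds \<open>40 * \<eta> = 2 / (5 * n ^ 3)\<close>.\<close>
  define \<delta> where "\<delta> = sqrt (1 / (2 * n ^ 3))"
  have \<delta>: "\<delta> \<ge> 0" "\<delta>\<^sup>2 = 1 / (2 * n ^ 3)"
    using n by (auto simp: \<delta>_def)
  have spread: "(n - 1) ^ 3 * \<delta>\<^sup>2
      < (\<Sum>k\<in>UNIV. (norm (w $ k))\<^sup>2) - (norm (\<Sum>k\<in>UNIV. w $ k))\<^sup>2 / n"
  proof -
    have "(n - 1) ^ 3 \<le> n ^ 3"
      using n by (intro power_mono) auto
    then have "(n - 1) ^ 3 * \<delta>\<^sup>2 \<le> 1 / 2"
      using n by (simp add: \<delta> field_simps)
    moreover have "(1 - \<eta>)\<^sup>2 \<le> (norm w)\<^sup>2"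
    proof (rule power_mono)
      show "1 - \<eta> \<le> norm w"
        using mult_left_mono[OF lower[of T], of "inverse T"] T
        by (simp add: w_def \<eta>_def right_diff_distrib divide_inverse_commute)
    qed (use \<eta>_le in simp)
    \<comment> \<open>Zero momentum freezes the sum of the centres at its initial value;
      Cauchy-Schwarz costs a factor \<open>n\<close>, which the division by \<open>n\<close>
      removes.\<close>
    moreover have "(norm (\<Sum>k\<in>UNIV. w $ k))\<^sup>2 / n \<le> \<eta>\<^sup>2"
    proof -
      have "(\<Sum>k\<in>UNIV. x T $ k) = (\<Sum>k\<in>UNIV. x 0 $ k)"
        using ev[of 0 T] T v by simp
      then have "(\<Sum>k\<in>UNIV. w $ k) = (\<Sum>k\<in>UNIV. x 0 $ k) /\<^sub>R T"
        by (simp add: w_def flip: scaleR_sum_right)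
      moreover have "(norm (\<Sum>k\<in>UNIV. x 0 $ k))\<^sup>2 \<le> n * r\<^sup>2"
      proof -
        have "(norm (\<Sum>k\<in>UNIV. x 0 $ k))\<^sup>2 \<le> (\<Sum>k\<in>UNIV. norm (x 0 $ k))\<^sup>2"
          by (intro power_mono norm_sum) auto
        also have "\<dots> \<le> n * r\<^sup>2"
          using sum_squared_le_sum_of_squares[of "\<lambda>k. norm (x 0 $ k)" UNIV]
          by (simp add: n_def r_def sq_vec mult.commute)
        finally show ?thesis .
      qed
      ultimately show ?thesis
        using n T by (simp add: \<eta>_def power_divide power_mult_distrib field_simps)
    qed
    moreover have "(1 - \<eta>)\<^sup>2 - \<eta>\<^sup>2 = 1 - 2 * \<eta>"
      by (simp add: power2_eq_square algebra_simps)
    ultimately show ?thesis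
      using \<eta>_le unfolding sq_vec[symmetric] by linarith
  qed
  obtain A where A: "A \<noteq> {}" "- A \<noteq> {}"
    and gap: "\<And>j k. j \<in> A \<Longrightarrow> k \<notin> A \<Longrightarrow> norm (w $ k - w $ j) > \<delta>"
    using exists_gap[of \<delta> "\<lambda>k. w $ k"] spread \<delta>(1) unfolding n_def by blast
  have "\<not> collide x t j k" if t: "t > T" and jk: "j \<in> A" "k \<notin> A" for t j k
  proof
    assume "collide x t j k"
    then have contact: "norm (x t $ j - x t $ k) = 2" and "k \<noteq> j"
      by (auto simp: collide_def in_contact_def)
    define u where "u = x t /\<^sub>R t"
    have t0: "t > 0" using t T by simp
    have "(norm (u - w))\<^sup>2 \<le> 8 * \<eta> + \<eta>\<^sup>2"
      unfolding u_def w_def \<eta>_def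
      using t T r by (intro direction_change lower upper speed) auto
    then have D: "(norm ((w - u) $ k - (w - u) $ j))\<^sup>2 \<le> 16 * \<eta> + 2 * \<eta>\<^sup>2"
      using pair_le[OF \<open>k \<noteq> j\<close>, of "w - u"] by (simp add: norm_minus_commute)
    have "norm (u $ k - u $ j) = 2 / t"
      using contact t0
      by (simp add: u_def norm_minus_commute divide_inverse_commute flip: scaleR_right_diff_distrib)
    then have "(norm (u $ k - u $ j))\<^sup>2 = 4 / t\<^sup>2"
      by (simp add: power_divide)
    \<comment> \<open>Uses \<open>4 \<le> 2 * r\<^sup>2\<close> in the numerator and
      \<open>T < t\<close> in the denominator.\<close>
    also have "\<dots> \<le> 2 * r\<^sup>2 / T\<^sup>2"
      using r2 t T by (intro frac_le power_mono) auto
    also have "\<dots> = 2 * \<eta>\<^sup>2"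
      by (simp add: \<eta>_def power_divide)
    finally have U: "(norm (u $ k - u $ j))\<^sup>2 \<le> 2 * \<eta>\<^sup>2" .
    have par: "(norm (a + b))\<^sup>2 \<le> 2 * (norm a)\<^sup>2 + 2 * (norm b)\<^sup>2" for a b :: "real^'d"
      using zero_le_power2[of "norm (a - b)"]
      by (simp add: power2_norm_eq_inner inner_diff_left inner_diff_right inner_add_left
          inner_add_right inner_commute)
    \<comment> \<open>Contact part plus drift since \<open>T\<close>: the bounds \<open>U\<close>
      and \<open>D\<close>, each doubled by \<open>par\<close>, add up to
      \<open>32 * \<eta> + 8 * \<eta>\<^sup>2\<close>.\<close>
    have "w $ k - w $ j = (u $ k - u $ j) + ((w - u) $ k - (w - u) $ j)"
      by simp
    then have "(norm (w $ k - w $ j))\<^sup>2 \<le> 32 * \<eta> + 8 * (\<eta> * \<eta>)"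
      using par[of "u $ k - u $ j" "(w - u) $ k - (w - u) $ j"] D U by (simp add: power2_eq_square)
    also have "\<eta> * \<eta> \<le> \<eta> * 1"
      using \<eta> \<eta>_le by (intro mult_left_mono) auto
    finally have "(norm (w $ k - w $ j))\<^sup>2 \<le> 40 * \<eta>"
      by simp
    moreover have "40 * \<eta> < \<delta>\<^sup>2"
      using n by (simp add: \<eta>(1) \<delta>(2) field_simps)
    moreover have "\<delta>\<^sup>2 < (norm (w $ k - w $ j))\<^sup>2"
      using gap[OF jk] \<delta>(1) by (intro power_strict_mono) auto
    ultimately show False by simp
  qed
  then show ?thesis
    using A by (intro exI[of _ A] exI[of _ "- A"]) (auto simp: T_def n_def r_def)
qed

end
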